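(* Let $(Y_n)_n$, $(Y'_n)_n$ be two independent sequences of independent standard Gaussian random variables, let $(c_k)_{k\ge0}\in\ell^2$, and let $\{x_t\}_{t\in[0,1]}\in\mathscr{H}$ be the limit, in mean square and uniformly in $t$, of $$c_0Y'_0+\sum_{k=1}^{n}c_k\big(Y_k\sqrt2\sin(2k\pi t)+Y'_k\sqrt2\cos(2k\pi t)\big)\qquad(n\to\infty).$$ Let $m$ be a positive integer and $0<\alpha\le1$. If $c_k^2=O\big(\frac{1}{k^{1+2m+\alpha}}\big)$, then almost all trajectories of $\{\partial^kx_t\}_{t\in[0,1]}$, with $k<m$, are Lipschitz continuous, and $\{x_t\}_{t\in[0,1]}$ admits, as a function of $t$, a continuous derivative $\{\partial^mx_t\}_{t\in[0,1]}$ of order $m$ that is Hölder continuous of order $\beta$, for all $\beta<\frac{\alpha}{2}$.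
   Context: $\mathscr{H}$ denotes the set of real Gaussian stochastic processes $\{x_t\}_{t\in[0,1]}$ such that: $E(x_t)=0$ for all $t$; the process is continuously stationary, i.e. its covariance function $C(s,t)=\mathrm{Cov}(x_s,x_t)$ satisfies $C(s,t)=\tilde C(s-t)$ for all $s,t$ for some real continuous function $\tilde C$ (the covariogram function); and the process is periodical, i.e. $x_0=x_1$ almost surely. $\partial^kx_t$ denotes the $k$-th derivative of the trajectory $t\mapsto x_t$ (with $\partial^0x_t=x_t$). Convergence in mean square, uniformly in $t$, of $S_n(t)$ to $x_t$ means $\sup_{t\in[0,1]}E\big[(x_t-S_n(t))^2\big]\to0$.
   Formalization: The trajectory properties are stated for a modification of {x_t} on the same probability space, since a mean-square limit fixes x_t only almost surely for each t and an arbitrary version may have discontinuous trajectories. *)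

theory Defs
  imports "HOL-Probability.Probability" "HOL-Library.Landau_Symbols"
begin

text \<open>Gaussian laws include the degenerate ones (point masses), so that processes such as
  \<open>x = 0\<close> count as Gaussian.\<close>

definition gaussian_rv :: "'a measure \<Rightarrow> ('a \<Rightarrow> real) \<Rightarrow> bool" where
  "gaussian_rv M X \<longleftrightarrow> X \<in> borel_measurable M \<and>
     ((\<exists>\<mu> \<sigma>. 0 < \<sigma> \<and> distributed M lborel X (normal_density \<mu> \<sigma>)) \<or>
      (\<exists>\<mu>. AE \<omega> in M. X \<omega> = \<mu>))"

text \<open>A process indexed by \<open>T\<close> is a total function of which only the values at \<open>t \<in> T\<close> matter.\<close>

definition gaussian_process :: "'a measure \<Rightarrow> 'i set \<Rightarrow> ('i \<Rightarrow> 'a \<Rightarrow> real) \<Rightarrow> bool" where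
  "gaussian_process M T x \<longleftrightarrow>
     (\<forall>J a. finite J \<and> J \<subseteq> T \<longrightarrow> gaussian_rv M (\<lambda>\<omega>. \<Sum>t\<in>J. a t * x t \<omega>))"

definition covariance :: "'a measure \<Rightarrow> ('a \<Rightarrow> real) \<Rightarrow> ('a \<Rightarrow> real) \<Rightarrow> real" where
  "covariance M X Y =
     (LINT \<omega>|M. (X \<omega> - (LINT \<omega>'|M. X \<omega>')) * (Y \<omega> - (LINT \<omega>'|M. Y \<omega>')))"

text \<open>For \<open>s, t \<in> [0,1]\<close> the covariogram is only evaluated on \<open>[-1,1]\<close>.\<close>

definition continuously_stationary :: "'a measure \<Rightarrow> (real \<Rightarrow> 'a \<Rightarrow> real) \<Rightarrow> bool" where
  "continuously_stationary M x \<longleftrightarrow>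
     (\<exists>C :: real \<Rightarrow> real. continuous_on {-1..1} C \<and>
        (\<forall>s\<in>{0..1}. \<forall>t\<in>{0..1}. covariance M (x s) (x t) = C (s - t)))"

definition periodic_stationary_gaussian :: "'a measure \<Rightarrow> (real \<Rightarrow> 'a \<Rightarrow> real) set" where
  "periodic_stationary_gaussian M =
     {x. gaussian_process M {0..1} x \<and>
         (\<forall>t\<in>{0..1}. (LINT \<omega>|M. x t \<omega>) = 0) \<and>
         continuously_stationary M x \<and>
         (AE \<omega> in M. x 0 \<omega> = x 1 \<omega>)}"

definition fourier_partial_sum ::
    "(nat \<Rightarrow> real) \<Rightarrow> (nat \<Rightarrow> 'a \<Rightarrow> real) \<Rightarrow> (nat \<Rightarrow> 'a \<Rightarrow> real) \<Rightarrow> nat \<Rightarrow> real \<Rightarrow> 'a \<Rightarrow> real" where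
  "fourier_partial_sum c Y Y' n t \<omega> =
     c 0 * Y' 0 \<omega> +
     (\<Sum>k=1..n. c k * (Y k \<omega> * sqrt 2 * sin (2 * real k * pi * t) +
                       Y' k \<omega> * sqrt 2 * cos (2 * real k * pi * t)))"

text \<open>The mean squares are taken in \<^typ>\<open>ennreal\<close>, where the supremum and the integral need no
  boundedness or integrability side conditions.\<close>

definition mean_square_uniform_limit ::
    "'a measure \<Rightarrow> 'i set \<Rightarrow> (nat \<Rightarrow> 'i \<Rightarrow> 'a \<Rightarrow> real) \<Rightarrow> ('i \<Rightarrow> 'a \<Rightarrow> real) \<Rightarrow> bool" where
  "mean_square_uniform_limit M T S x \<longleftrightarrow>
     (\<lambda>n. SUP t\<in>T. \<integral>\<^sup>+\<omega>. ennreal ((x t \<omega> - S n t \<omega>)\<^sup>2) \<partial>M) \<longlonglongrightarrow> 0"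

definition modification ::
    "'a measure \<Rightarrow> 'i set \<Rightarrow> ('i \<Rightarrow> 'a \<Rightarrow> real) \<Rightarrow> ('i \<Rightarrow> 'a \<Rightarrow> real) \<Rightarrow> bool" where
  "modification M T x z \<longleftrightarrow>
     (\<forall>t\<in>T. z t \<in> borel_measurable M \<and> (AE \<omega> in M. z t \<omega> = x t \<omega>))"

text \<open>Derivatives relative to \<open>S\<close>: for \<open>S = {0..1}\<close> these are one-sided at the end points.\<close>

primrec nth_deriv_within :: "nat \<Rightarrow> real set \<Rightarrow> (real \<Rightarrow> real) \<Rightarrow> real \<Rightarrow> real" where
  "nth_deriv_within 0 S f = f"
| "nth_deriv_within (Suc k) S f =
     (\<lambda>t. vector_derivative (nth_deriv_within k S f) (at t within S))"

definition times_differentiable_on :: "nat \<Rightarrow> real set \<Rightarrow> (real \<Rightarrow> real) \<Rightarrow> bool" where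
  "times_differentiable_on m S f \<longleftrightarrow> (\<forall>k<m. nth_deriv_within k S f differentiable_on S)"

definition hoelder_continuous_on :: "real \<Rightarrow> real set \<Rightarrow> (real \<Rightarrow> real) \<Rightarrow> bool" where
  "hoelder_continuous_on \<beta> S f \<longleftrightarrow>
     (\<exists>K\<ge>0. \<forall>s\<in>S. \<forall>t\<in>S. \<bar>f s - f t\<bar> \<le> K * \<bar>s - t\<bar> powr \<beta>)"

end

theory Submission
  imports Defs "HOL-Real_Asymp.Real_Asymp"
begin

text \<open>
  The regular modification is the Fourier series itself, summed over the dyadic blocks
  \<open>2 ^ j \<le> k < 2 ^ (j + 1)\<close>. Put \<open>a = \<alpha> / 2\<close>. The coefficients of the \<open>m\<close>-th derivative are
  at most of order \<open>k powr - (1/2 + a)\<close>, so its \<open>j\<close>-th block has, at a fixed time, standard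
  deviation at most of order \<open>2 powr - (j * a)\<close>. The main point is that almost surely the same order is valid for
  the supremum over all times, up to a factor \<open>2 powr (j * \<epsilon>)\<close> with \<open>\<epsilon>\<close> as small as desired
  (\<open>random_trig_block_bound\<close>): a trigonometric polynomial of degree at most \<open>2 ^ (j + 1)\<close>
  with coefficients of at most this order is controlled by its values on a grid of mesh
  \<open>1 / 8 ^ j\<close>, and the Gaussian tail (\<open>std_normal_sum_tail\<close>) at the raised threshold is much
  smaller than the inverse of the number of grid points, so that Borel-Cantelli applies. The sine and the cosine parts each satisfy this bound
  almost surely, and hence so does their sum.

  For each \<open>\<delta> < a\<close> the blocks of all derivatives of order at most \<open>m\<close> are therefore
  uniformly of order \<open>2 powr - (j * \<delta>)\<close>, and the blocks of the derivative of order \<open>m + 1\<close> are of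
  order \<open>2 powr (j * (1 - \<delta>))\<close>. What remains is deterministic (\<open>smooth_dyadic_series\<close>). The first
  bound allows \<open>m\<close> termwise differentiations, and the derivatives of order less than \<open>m\<close> are
  Lipschitz because their own derivatives are bounded. Comparing both bounds with the distance
  of two times shows that the \<open>m\<close>-th derivative is Hoelder continuous of each order
  \<open>\<beta> < \<delta>\<close> (\<open>hoelder_dyadic_series\<close>).

  The sum of the series is a modification of the process, because a mean square limit and an
  almost sure limit of the same sequence agree almost surely (\<open>AE_eq_of_mean_square_limit\<close>).
\<close>

section \<open>Gaussian tails\<close>

text \<open>Completing the square turns the tilted standard normal density into the density centred
  at \<open>c\<close>, up to the factor \<open>exp (c\<^sup>2 / 2)\<close>.\<close>

lemma nn_integral_exp_std_normal:
  "(\<integral>\<^sup>+x. ennreal (std_normal_density x) * ennreal (exp (c * x)) \<partial>lborel) = ennreal (exp (c\<^sup>2 / 2))"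
proof -
  have eq: "std_normal_density x * exp (c * x) = exp (c\<^sup>2 / 2) * normal_density c 1 x" for x
    by (simp add: normal_density_def flip: exp_add) (simp add: power2_eq_square field_simps)
  have "(\<integral>\<^sup>+x. ennreal (std_normal_density x) * ennreal (exp (c * x)) \<partial>lborel)
      = (\<integral>\<^sup>+x. ennreal (exp (c\<^sup>2 / 2)) * ennreal (normal_density c 1 x) \<partial>lborel)"
    by (intro nn_integral_cong) (simp add: eq flip: ennreal_mult)
  also have "\<dots> = ennreal (exp (c\<^sup>2 / 2)) * (\<integral>\<^sup>+x. ennreal (normal_density c 1 x) \<partial>lborel)"
    by (intro nn_integral_cmult) simp
  also have "(\<integral>\<^sup>+x. ennreal (normal_density c 1 x) \<partial>lborel) = 1"
    using prob_space.emeasure_space_1[OF prob_space_normal_density[of 1 c]]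
    by (simp add: emeasure_density)
  finally show ?thesis by simp
qed

text \<open>The Chernoff bound: by independence the exponential moments of the sum multiply, so at
  \<open>l > 0\<close> the probability is at most \<open>exp (l\<^sup>2 * V / 2 - l * u)\<close>, which is smallest at \<open>l = u / V\<close>.
  Working with exponential moments rather than with the law of the sum allows vanishing
  coefficients.\<close>

lemma (in prob_space) std_normal_sum_upper_tail:
  fixes Y :: "'i \<Rightarrow> 'a \<Rightarrow> real"
  assumes Y: "\<And>k. distributed M lborel (Y k) std_normal_density"
    and ind: "indep_vars (\<lambda>_. borel) Y UNIV"
    and fin: "finite I" and V: "(\<Sum>k\<in>I. (a k)\<^sup>2) \<le> V" "0 < V" and u: "0 < u"
  shows "prob {\<omega>\<in>space M. u \<le> (\<Sum>k\<in>I. a k * Y k \<omega>)} \<le> exp (- (u\<^sup>2 / (2 * V)))"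
proof -
  have [measurable]: "Y k \<in> borel_measurable M" for k
    using distributed_measurable[OF Y[of k]] by simp
  define l where "l = u / V"
  have l: "0 < l" using u V by (simp add: l_def)
  have "ennreal (prob {\<omega>\<in>space M. u \<le> (\<Sum>k\<in>I. a k * Y k \<omega>)})
      = emeasure M {\<omega>\<in>space M. u \<le> (\<Sum>k\<in>I. a k * Y k \<omega>)}"
    by (simp add: emeasure_eq_measure)
  also have "\<dots> \<le> ennreal (exp (- l * u)) * (\<integral>\<^sup>+\<omega>\<in>space M. exp (l * (\<Sum>k\<in>I. a k * Y k \<omega>)) \<partial>M)"
    by (intro Chernoff_ineq_nn_integral_ge l) auto
  also have "(\<integral>\<^sup>+\<omega>\<in>space M. exp (l * (\<Sum>k\<in>I. a k * Y k \<omega>)) \<partial>M)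
      = (\<integral>\<^sup>+\<omega>. (\<Prod>k\<in>I. ennreal (exp ((l * a k) * Y k \<omega>))) \<partial>M)"
    by (intro nn_integral_cong) (simp add: sum_distrib_left exp_sum fin prod_ennreal mult.assoc)
  also have "\<dots> = (\<Prod>k\<in>I. \<integral>\<^sup>+\<omega>. ennreal (exp ((l * a k) * Y k \<omega>)) \<partial>M)"
    by (intro indep_vars_nn_integral fin indep_vars_compose2[OF indep_vars_subset[OF ind]]) auto
  also have "\<dots> = (\<Prod>k\<in>I. ennreal (exp ((l * a k)\<^sup>2 / 2)))"
  proof (intro prod.cong refl)
    fix k
    show "(\<integral>\<^sup>+\<omega>. ennreal (exp ((l * a k) * Y k \<omega>)) \<partial>M) = ennreal (exp ((l * a k)\<^sup>2 / 2))"
      using distributed_nn_integral[OF Y[of k], of "\<lambda>x. ennreal (exp ((l * a k) * x))"]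
      by (simp add: nn_integral_exp_std_normal)
  qed
  also have "\<dots> = ennreal (exp (l\<^sup>2 * (\<Sum>k\<in>I. (a k)\<^sup>2) / 2))"
    by (simp add: prod_ennreal exp_sum fin sum_distrib_left sum_divide_distrib power_mult_distrib)
  also have "ennreal (exp (- l * u)) * \<dots> \<le> ennreal (exp (- l * u)) * ennreal (exp (l\<^sup>2 * V / 2))"
    using V by (intro mult_left_mono ennreal_leI) (auto intro!: mult_left_mono)
  also have "\<dots> = ennreal (exp (- (u\<^sup>2 / (2 * V))))"
    using V by (simp add: l_def power2_eq_square field_simps flip: ennreal_mult exp_add)
  finally show ?thesis by simp
qed

lemma (in prob_space) std_normal_sum_tail:
  fixes Y :: "'i \<Rightarrow> 'a \<Rightarrow> real"
  assumes Y: "\<And>k. distributed M lborel (Y k) std_normal_density"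
    and ind: "indep_vars (\<lambda>_. borel) Y UNIV"
    and fin: "finite I" and V: "(\<Sum>k\<in>I. (a k)\<^sup>2) \<le> V" "0 < V" and u: "0 < u"
  shows "prob {\<omega>\<in>space M. u \<le> \<bar>\<Sum>k\<in>I. a k * Y k \<omega>\<bar>} \<le> 2 * exp (- (u\<^sup>2 / (2 * V)))"
proof -
  have [measurable]: "Y k \<in> borel_measurable M" for k
    using distributed_measurable[OF Y[of k]] by simp
  have "{\<omega>\<in>space M. u \<le> \<bar>\<Sum>k\<in>I. a k * Y k \<omega>\<bar>}
      = {\<omega>\<in>space M. u \<le> (\<Sum>k\<in>I. a k * Y k \<omega>)} \<union> {\<omega>\<in>space M. u \<le> (\<Sum>k\<in>I. - a k * Y k \<omega>)}"
    by (auto simp: sum_negf)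
  also have "prob \<dots> \<le> prob {\<omega>\<in>space M. u \<le> (\<Sum>k\<in>I. a k * Y k \<omega>)}
      + prob {\<omega>\<in>space M. u \<le> (\<Sum>k\<in>I. - a k * Y k \<omega>)}"
    by (intro measure_Un_le) auto
  also have "\<dots> \<le> exp (- (u\<^sup>2 / (2 * V))) + exp (- (u\<^sup>2 / (2 * V)))"
    using V by (intro add_mono std_normal_sum_upper_tail[OF Y ind fin _ _ u]) auto
  finally show ?thesis by simp
qed

text \<open>The tails \<open>exp (- k\<^sup>2 / 2)\<close> are summable, so Borel-Cantelli applies. This crude growth bound
  serves only to control a random trigonometric polynomial between two grid points.\<close>

lemma (in prob_space) std_normal_sequence_AE_le_index:
  fixes Y :: "nat \<Rightarrow> 'a \<Rightarrow> real"
  assumes Y: "\<And>k. distributed M lborel (Y k) std_normal_density"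
    and ind: "indep_vars (\<lambda>_. borel) Y UNIV"
  shows "AE \<omega> in M. eventually (\<lambda>k. \<bar>Y k \<omega>\<bar> \<le> real k) sequentially"
proof -
  have [measurable]: "Y k \<in> borel_measurable M" for k
    using distributed_measurable[OF Y[of k]] by simp
  let ?A = "\<lambda>k. {\<omega>\<in>space M. real k \<le> \<bar>Y k \<omega>\<bar>}"
  have tail: "prob (?A k) \<le> 2 * exp (- ((real k)\<^sup>2 / 2))" for k
  proof (cases "k = 0")
    case True
    then show ?thesis using prob_le_1[of "?A k"] by (simp del: prob_le_1)
  next
    case False
    then show ?thesis using std_normal_sum_tail[OF Y ind, of "{k}" "\<lambda>_. 1" 1 "real k"] by simp
  qed
  have "summable (\<lambda>k. 2 * exp (- ((real k)\<^sup>2 / 2)))"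
  proof (rule summable_comparison_test_bigo)
    show "summable (\<lambda>k. norm ((1/2 :: real) ^ k))" by simp
    show "(\<lambda>k. 2 * exp (- ((real k)\<^sup>2 / 2))) \<in> O(\<lambda>k. (1/2) ^ k)" by real_asymp
  qed
  then have sum: "summable (\<lambda>k. prob (?A k))"
  proof (rule summable_comparison_test_ev[OF always_eventually[OF allI], rotated])
    fix k
    show "norm (prob (?A k)) \<le> 2 * exp (- ((real k)\<^sup>2 / 2))"
      unfolding real_norm_def abs_of_nonneg[OF measure_nonneg] by (rule tail)
  qed
  have "AE \<omega> in M. eventually (\<lambda>k. \<omega> \<in> space M - ?A k) sequentially"
    by (rule borel_cantelli_AE1[OF _ _ sum]) (simp_all add: emeasure_eq_measure)
  then show ?thesis
    by eventually_elim (auto elim!: eventually_mono)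
qed

section \<open>Uniform bounds for random trigonometric polynomials\<close>

definition dyadic_block :: "nat \<Rightarrow> nat set" where
  "dyadic_block j = {2 ^ j..<2 ^ Suc j}"

lemma finite_dyadic_block [simp]: "finite (dyadic_block j)"
  by (simp add: dyadic_block_def)

lemma card_dyadic_block [simp]: "card (dyadic_block j) = 2 ^ j"
  by (simp add: dyadic_block_def)

lemma dyadic_blockD:
  assumes "k \<in> dyadic_block j"
  shows "2 ^ j \<le> real k" "real k \<le> 2 ^ Suc j" "j < k"
proof -
  have "2 ^ j \<le> k" "k < 2 ^ Suc j" using assms by (auto simp: dyadic_block_def)
  then have "real (2 ^ j) \<le> real k" "real k \<le> real (2 ^ Suc j)" "j < k"
    using less_exp[of j] by (auto simp only: of_nat_le_iff intro: less_le_trans)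
  then show "2 ^ j \<le> real k" "real k \<le> 2 ^ Suc j" "j < k" by auto
qed

lemma abs_sin_diff_le: "\<bar>sin x - sin y\<bar> \<le> \<bar>x - y\<bar>" for x y :: real
  using field_differentiable_bound[of UNIV sin cos 1 x y]
  by (auto intro!: derivative_eq_intros)

lemma grid_point:
  assumes t: "t \<in> {0..1::real}" and n: "0 < n"
  obtains i :: nat where "i \<le> n" "\<bar>t - real i / real n\<bar> \<le> 1 / real n"
proof
  have "0 \<le> t * n" "t * n \<le> n" using t by (auto simp: mult_left_le_one_le)
  then show "nat \<lfloor>t * n\<rfloor> \<le> n" by linarith
  have "real (nat \<lfloor>t * n\<rfloor>) \<le> t * n" "t * n \<le> real (nat \<lfloor>t * n\<rfloor>) + 1"
    using \<open>0 \<le> t * n\<close> by linarith+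
  then have "\<bar>t * n - real (nat \<lfloor>t * n\<rfloor>)\<bar> \<le> 1" by linarith
  moreover have "t - real (nat \<lfloor>t * n\<rfloor>) / real n = (t * n - real (nat \<lfloor>t * n\<rfloor>)) / real n"
    using n by (simp add: diff_divide_distrib)
  ultimately show "\<bar>t - real (nat \<lfloor>t * n\<rfloor>) / real n\<bar> \<le> 1 / real n"
    using n by (simp add: abs_divide divide_right_mono)
qed

text \<open>The union bound below runs over \<open>8 ^ j + 1\<close> grid points. The doubly exponential decay of the
  tail at each point beats this number, whatever the value of \<open>\<epsilon> > 0\<close>.\<close>

lemma summable_grid_tail:
  assumes "0 < \<epsilon>"
  shows "summable (\<lambda>j. (8 ^ j + 1) * (2 * exp (- (2 powr (2 * \<epsilon> * real j) / 2))))"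
proof (rule summable_comparison_test_ev)
  have "filterlim (\<lambda>x::real. exp (c * x) / 2 - K * x) at_top at_top" if "0 < c" "0 < K" for c K
    using that by real_asymp
  \<comment> \<open>A tail below \<open>1 / 16 ^ j\<close> leaves a geometric series after multiplication by \<open>8 ^ j\<close>.\<close>
  from this[of "2 * \<epsilon> * ln 2" "ln 16"]
  have "filterlim (\<lambda>x::real. exp (2 * \<epsilon> * ln 2 * x) / 2 - ln 16 * x) at_top at_top"
    using assms by simp
  then have "filterlim (\<lambda>j. exp (2 * \<epsilon> * ln 2 * real j) / 2 - ln 16 * real j) at_top sequentially"
    by (rule filterlim_compose) (rule filterlim_real_sequentially)
  then have "eventually (\<lambda>j. 0 \<le> exp (2 * \<epsilon> * ln 2 * real j) / 2 - ln 16 * real j) sequentially"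
    by (rule filterlim_at_top[THEN iffD1, rule_format])
  then show "eventually (\<lambda>j. norm ((8 ^ j + 1) * (2 * exp (- (2 powr (2 * \<epsilon> * real j) / 2))))
      \<le> 4 * (1 / 2) ^ j) sequentially"
  proof eventually_elim
    case (elim j)
    have "exp (- (2 powr (2 * \<epsilon> * real j) / 2)) \<le> exp (- (real j * ln 16))"
      using elim by (simp add: powr_def mult_ac)
    also have "\<dots> = 1 / 16 ^ j"
      by (simp add: exp_minus exp_of_nat_mult divide_inverse)
    finally have "(8 ^ j + 1) * (2 * exp (- (2 powr (2 * \<epsilon> * real j) / 2)))
        \<le> (8 ^ j + 8 ^ j) * (2 * (1 / 16 ^ j))"
      by (intro mult_mono) auto
    also have "(16::real) ^ j = 8 ^ j * 2 ^ j" by (simp flip: power_mult_distrib)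
    finally show ?case by (simp add: power_one_over)
  qed
qed simp

text \<open>As the coefficients are at most \<open>1\<close>, block \<open>j\<close> has variance at most \<open>2 ^ j\<close> at each point. On the grid of
  mesh \<open>1 / 8 ^ j\<close> the Gaussian tail and the union bound exclude, for almost every \<open>\<omega>\<close> and all
  large \<open>j\<close>, values above \<open>2 powr (j / 2 + j * \<epsilon>)\<close>. Off the grid it suffices that the \<open>2 ^ j\<close>
  summands have frequency and \<open>\<bar>Y k \<omega>\<bar>\<close> of order at most \<open>2 ^ j\<close>: the polynomial is then Lipschitz
  with a constant of order \<open>8 ^ j\<close>, and moving to the nearest grid point changes it by a bounded
  amount. The finitely many remaining blocks only enlarge \<open>C\<close>.\<close>

lemma (in prob_space) random_trig_block_bound_unit:
  fixes Y :: "nat \<Rightarrow> 'a \<Rightarrow> real"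
  assumes Y: "\<And>k. distributed M lborel (Y k) std_normal_density"
    and ind: "indep_vars (\<lambda>_. borel) Y UNIV"
    and b: "\<And>j k. k \<in> dyadic_block j \<Longrightarrow> \<bar>b j k\<bar> \<le> 1"
    and eps: "0 < \<epsilon>"
  shows "AE \<omega> in M. \<exists>C. \<forall>j. \<forall>t\<in>{0..1}.
    \<bar>\<Sum>k\<in>dyadic_block j. b j k * Y k \<omega> * sin (2 * pi * real k * t + \<phi>)\<bar>
      \<le> C * 2 powr (real j * (1/2 + \<epsilon>))"
proof -
  have [measurable]: "Y k \<in> borel_measurable M" for k
    using distributed_measurable[OF Y[of k]] by simp
  define Z where "Z j t \<omega> = (\<Sum>k\<in>dyadic_block j. b j k * Y k \<omega> * sin (2 * pi * real k * t + \<phi>))"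
    for j t \<omega>
  define u :: "nat \<Rightarrow> real" where "u j = 2 powr (real j * (1/2 + \<epsilon>))" for j
  have [measurable]: "Z j t \<in> borel_measurable M" for j t unfolding Z_def by measurable
  have u1: "1 \<le> u j" for j using eps by (auto simp: u_def intro!: ge_one_powr_ge_zero)
  define A where "A j = (\<Union>i\<le>8^j. {\<omega>\<in>space M. u j \<le> \<bar>Z j (real i / real (8^j)) \<omega>\<bar>})" for j
  have tail: "prob {\<omega>\<in>space M. u j \<le> \<bar>Z j t \<omega>\<bar>} \<le> 2 * exp (- (2 powr (2 * \<epsilon> * real j) / 2))" for j t
  proof -
    have "prob {\<omega>\<in>space M. u j \<le> \<bar>\<Sum>k\<in>dyadic_block j. b j k * sin (2 * pi * real k * t + \<phi>) * Y k \<omega>\<bar>}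
        \<le> 2 * exp (- ((u j)\<^sup>2 / (2 * 2^j)))"
    proof (rule std_normal_sum_tail[OF Y ind])
      have "(b j k * sin (2 * pi * real k * t + \<phi>))\<^sup>2 \<le> 1" if "k \<in> dyadic_block j" for k
        using b[OF that] by (subst abs_square_le_1) (auto simp: abs_mult intro!: mult_le_one)
      from sum_mono[OF this, of "dyadic_block j"]
      show "(\<Sum>k\<in>dyadic_block j. (b j k * sin (2 * pi * real k * t + \<phi>))\<^sup>2) \<le> 2 ^ j" by simp
    qed (use u1[of j] in auto)
    moreover have "(u j)\<^sup>2 / (2 * 2^j) = 2 powr (2 * \<epsilon> * real j) / 2"
    proof -
      have "(u j)\<^sup>2 = 2 powr (2 * \<epsilon> * real j) * 2 powr (real j)"
        unfolding u_def by (simp add: power2_eq_square algebra_simps flip: powr_add)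
      then show ?thesis by (simp add: powr_realpow)
    qed
    ultimately show ?thesis unfolding Z_def by (simp add: mult_ac)
  qed
  have A_le: "prob (A j) \<le> (8^j + 1) * (2 * exp (- (2 powr (2 * \<epsilon> * real j) / 2)))" for j
  proof -
    have "prob (A j) \<le> (\<Sum>i\<le>8^j. prob {\<omega>\<in>space M. u j \<le> \<bar>Z j (real i / real (8^j)) \<omega>\<bar>})"
      unfolding A_def by (intro finite_measure_subadditive_finite) auto
    also have "\<dots> \<le> (\<Sum>i\<le>(8::nat)^j. 2 * exp (- (2 powr (2 * \<epsilon> * real j) / 2)))"
      by (intro sum_mono tail)
    finally show ?thesis by (simp add: add.commute)
  qed
  have sum: "summable (\<lambda>j. prob (A j))"
  proof (rule summable_comparison_test_ev[OF always_eventually[OF allI]])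
    fix j
    show "norm (prob (A j)) \<le> (8^j + 1) * (2 * exp (- (2 powr (2 * \<epsilon> * real j) / 2)))"
      unfolding real_norm_def abs_of_nonneg[OF measure_nonneg] by (rule A_le)
  qed (rule summable_grid_tail[OF eps])
  have A: "A j \<in> events" for j unfolding A_def by (intro sets.finite_UN) auto
  have "AE \<omega> in M. eventually (\<lambda>j. \<omega> \<in> space M - A j) sequentially"
    by (rule borel_cantelli_AE1[OF A _ sum]) (simp add: emeasure_eq_measure)
  with std_normal_sequence_AE_le_index[OF Y ind]
  show ?thesis
  proof eventually_elim
    fix \<omega> assume "eventually (\<lambda>k. \<bar>Y k \<omega>\<bar> \<le> real k) sequentially"
      "eventually (\<lambda>j. \<omega> \<in> space M - A j) sequentially"
    from eventually_conj[OF this] obtain N where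
      N: "\<And>k. k \<ge> N \<Longrightarrow> \<bar>Y k \<omega>\<bar> \<le> real k" "\<And>j. j \<ge> N \<Longrightarrow> \<omega> \<in> space M - A j"
      by (auto simp: eventually_sequentially)
    define S where "S j = (\<Sum>k\<in>dyadic_block j. \<bar>Y k \<omega>\<bar>)" for j
    have S0: "0 \<le> S j" for j by (auto simp: S_def intro: sum_nonneg)
    define C where "C = 1 + 8 * pi + (\<Sum>j<N. S j)"
    have "\<bar>Z j t \<omega>\<bar> \<le> C * u j" if t: "t \<in> {0..1}" for j t
    proof (cases "j < N")
      case True
      have "\<bar>Z j t \<omega>\<bar> \<le> S j" unfolding Z_def S_def
      proof (intro order.trans[OF sum_abs] sum_mono)
        fix k assume k: "k \<in> dyadic_block j"
        have "\<bar>b j k\<bar> * (\<bar>sin (2 * pi * real k * t + \<phi>)\<bar> * \<bar>Y k \<omega>\<bar>) \<le> 1 * (1 * \<bar>Y k \<omega>\<bar>)"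
          using b[OF k] by (intro mult_mono) auto
        then show "\<bar>b j k * Y k \<omega> * sin (2 * pi * real k * t + \<phi>)\<bar> \<le> \<bar>Y k \<omega>\<bar>"
          by (simp add: abs_mult mult_ac)
      qed
      also have "S j \<le> (\<Sum>j<N. S j)" using True S0 by (intro member_le_sum) auto
      also have "\<dots> \<le> C" by (simp add: C_def)
      also have "C \<le> C * u j"
        using u1[of j] S0 mult_left_mono[of 1 "u j" C] by (simp add: C_def sum_nonneg)
      finally show ?thesis .
    next
      case False
      obtain i :: nat where i: "i \<le> 8^j" "\<bar>t - real i / real (8^j)\<bar> \<le> 1 / real (8^j)"
        using grid_point[OF t, of "8^j"] by auto
      let ?s = "real i / real (8^j)"
      have "\<omega> \<in> space M - A j" using False by (intro N(2)) simp
      then have grid: "\<bar>Z j ?s \<omega>\<bar> \<le> u j" using i(1) unfolding A_def by (auto simp: not_le intro: less_imp_le)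
      have "\<bar>Z j t \<omega> - Z j ?s \<omega>\<bar> \<le> (\<Sum>k\<in>dyadic_block j. 8 * pi / 2^j)"
        unfolding Z_def sum_subtractf[symmetric]
      proof (intro order.trans[OF sum_abs] sum_mono)
        fix k assume k: "k \<in> dyadic_block j"
        note kk = dyadic_blockD[OF k]
        have "\<bar>sin (2 * pi * real k * t + \<phi>) - sin (2 * pi * real k * ?s + \<phi>)\<bar> \<le> \<bar>2 * pi * real k * (t - ?s)\<bar>"
          by (rule order.trans[OF abs_sin_diff_le]) (simp add: algebra_simps)
        also have "\<dots> = 2 * pi * real k * \<bar>t - ?s\<bar>" by (simp add: abs_mult)
        also have "\<dots> \<le> 2 * pi * 2 ^ Suc j * (1 / real (8^j))"
          using kk i by (intro mult_mono) auto
        finally have 1: "\<bar>sin (2 * pi * real k * t + \<phi>) - sin (2 * pi * real k * ?s + \<phi>)\<bar>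
          \<le> 2 * pi * 2 ^ Suc j * (1 / real (8^j))" .
        have "\<bar>Y k \<omega>\<bar> \<le> 2 ^ Suc j" using N(1)[of k] kk False by simp
        with b[OF k] 1 have "\<bar>b j k\<bar> * (\<bar>Y k \<omega>\<bar> * \<bar>sin (2 * pi * real k * t + \<phi>) - sin (2 * pi * real k * ?s + \<phi>)\<bar>)
           \<le> 1 * (2 ^ Suc j * (2 * pi * 2 ^ Suc j * (1 / real (8^j))))"
          by (intro mult_mono) auto
        also have "\<dots> = 8 * pi / 2^j"
        proof -
          have "(8::real)^j = 2^j * (2^j * 2^j)" by (simp flip: power_mult_distrib)
          then show ?thesis by simp
        qed
        finally show "\<bar>b j k * Y k \<omega> * sin (2 * pi * real k * t + \<phi>)
            - b j k * Y k \<omega> * sin (2 * pi * real k * ?s + \<phi>)\<bar> \<le> 8 * pi / 2 ^ j"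
          by (simp add: mult.assoc flip: abs_mult right_diff_distrib)
      qed
      then have "\<bar>Z j t \<omega> - Z j ?s \<omega>\<bar> \<le> 8 * pi" by simp
      with grid have "\<bar>Z j t \<omega>\<bar> \<le> u j + 8 * pi" by linarith
      also have "\<dots> \<le> (1 + 8 * pi) * u j"
        using u1[of j] mult_left_mono[of 1 "u j" "8 * pi"] by (simp add: algebra_simps)
      also have "\<dots> \<le> C * u j"
        using u1[of j] S0 by (intro mult_right_mono) (auto simp: C_def sum_nonneg)
      finally show ?thesis .
    qed
    then have "\<forall>j. \<forall>t\<in>{0..1}. \<bar>Z j t \<omega>\<bar> \<le> C * u j" by simp
    then show "\<exists>C. \<forall>j. \<forall>t\<in>{0..1}.
        \<bar>\<Sum>k\<in>dyadic_block j. b j k * Y k \<omega> * sin (2 * pi * real k * t + \<phi>)\<bar>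
         \<le> C * 2 powr (real j * (1/2 + \<epsilon>))"
      unfolding Z_def u_def by (rule exI[of _ C])
  qed
qed

lemma (in prob_space) random_trig_block_bound:
  fixes Y :: "nat \<Rightarrow> 'a \<Rightarrow> real"
  assumes Y: "\<And>k. distributed M lborel (Y k) std_normal_density"
    and ind: "indep_vars (\<lambda>_. borel) Y UNIV"
    and b: "\<And>j k. k \<in> dyadic_block j \<Longrightarrow> \<bar>b j k\<bar> \<le> s j"
    and eps: "0 < \<epsilon>"
  shows "AE \<omega> in M. \<exists>C. \<forall>j. \<forall>t\<in>{0..1}.
    \<bar>\<Sum>k\<in>dyadic_block j. b j k * Y k \<omega> * sin (2 * pi * real k * t + \<phi>)\<bar>
      \<le> C * s j * 2 powr (real j * (1/2 + \<epsilon>))"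
proof -
  have s0: "0 \<le> s j" for j
  proof -
    have "2 ^ j \<in> dyadic_block j" by (simp add: dyadic_block_def)
    from b[OF this] show ?thesis by linarith
  qed
  have unit: "\<bar>b j k / s j\<bar> \<le> 1" if "k \<in> dyadic_block j" for j k
    using b[OF that] s0[of j] by (cases "s j = 0") (auto simp: abs_divide)
  have "AE \<omega> in M. \<exists>C. \<forall>j. \<forall>t\<in>{0..1}.
      \<bar>\<Sum>k\<in>dyadic_block j. b j k / s j * Y k \<omega> * sin (2 * pi * real k * t + \<phi>)\<bar>
        \<le> C * 2 powr (real j * (1/2 + \<epsilon>))"
    by (rule random_trig_block_bound_unit[OF Y ind unit eps])
  then
  show ?thesis
  proof eventually_elim
    fix \<omega>
    assume "\<exists>C. \<forall>j. \<forall>t\<in>{0..1}.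
      \<bar>\<Sum>k\<in>dyadic_block j. b j k / s j * Y k \<omega> * sin (2 * pi * real k * t + \<phi>)\<bar>
        \<le> C * 2 powr (real j * (1/2 + \<epsilon>))"
    then obtain C where C: "\<And>j t. t \<in> {0..1} \<Longrightarrow>
      \<bar>\<Sum>k\<in>dyadic_block j. b j k / s j * Y k \<omega> * sin (2 * pi * real k * t + \<phi>)\<bar>
        \<le> C * 2 powr (real j * (1/2 + \<epsilon>))" by blast
    show "\<exists>C. \<forall>j. \<forall>t\<in>{0..1}.
      \<bar>\<Sum>k\<in>dyadic_block j. b j k * Y k \<omega> * sin (2 * pi * real k * t + \<phi>)\<bar>
        \<le> C * s j * 2 powr (real j * (1/2 + \<epsilon>))"
    proof (intro exI allI ballI)
      fix j and t :: real assume t: "t \<in> {0..1}"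
      have "b j k = s j * (b j k / s j)" if "k \<in> dyadic_block j" for k
        using b[OF that] by (cases "s j = 0") auto
      then have "(\<Sum>k\<in>dyadic_block j. b j k * Y k \<omega> * sin (2 * pi * real k * t + \<phi>))
          = s j * (\<Sum>k\<in>dyadic_block j. b j k / s j * Y k \<omega> * sin (2 * pi * real k * t + \<phi>))"
        unfolding sum_distrib_left by (intro sum.cong refl) (metis mult.assoc)
      also have "\<bar>\<dots>\<bar> \<le> s j * (C * 2 powr (real j * (1/2 + \<epsilon>)))"
        unfolding abs_mult abs_of_nonneg[OF s0] by (intro mult_left_mono C t s0)
      finally show "\<bar>\<Sum>k\<in>dyadic_block j. b j k * Y k \<omega> * sin (2 * pi * real k * t + \<phi>)\<bar>
          \<le> C * s j * 2 powr (real j * (1/2 + \<epsilon>))"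
        by (simp only: mult_ac)
    qed
  qed
qed

text \<open>The loss \<open>\<epsilon>\<close> can be taken along \<open>1 / n\<close>, so a single null set serves every exponent \<open>\<delta> < a\<close>.
  The parameter \<open>p\<close> leaves room for coefficients that have been multiplied by \<open>k ^ p\<close> through
  differentiation.\<close>

lemma (in prob_space) random_trig_block_decay:
  fixes Y :: "nat \<Rightarrow> 'a \<Rightarrow> real"
  assumes Y: "\<And>k. distributed M lborel (Y k) std_normal_density"
    and ind: "indep_vars (\<lambda>_. borel) Y UNIV"
    and d: "\<And>j k. k \<in> dyadic_block j \<Longrightarrow> \<bar>d k\<bar> \<le> A * 2 powr (real j * (p - 1/2 - a))"
  shows "AE \<omega> in M. \<forall>\<delta><a. \<exists>C. \<forall>j. \<forall>t\<in>{0..1}.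
    \<bar>\<Sum>k\<in>dyadic_block j. d k * Y k \<omega> * sin (2 * pi * real k * t + \<phi>)\<bar>
      \<le> C * 2 powr (real j * (p - \<delta>))"
proof -
  let ?Z = "\<lambda>\<omega> j t. \<Sum>k\<in>dyadic_block j. d k * Y k \<omega> * sin (2 * pi * real k * t + \<phi>)"
  have "AE \<omega> in M. \<forall>n. \<exists>C. \<forall>j. \<forall>t\<in>{0..1}. \<bar>?Z \<omega> j t\<bar>
      \<le> C * (A * 2 powr (real j * (p - 1/2 - a))) * 2 powr (real j * (1/2 + 1 / real (Suc n)))"
    unfolding AE_all_countable
    by (intro allI random_trig_block_bound[OF Y ind d]) auto
  then show ?thesis
  proof eventually_elim
    fix \<omega>
    assume *: "\<forall>n. \<exists>C. \<forall>j. \<forall>t\<in>{0..1}. \<bar>?Z \<omega> j t\<bar>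
      \<le> C * (A * 2 powr (real j * (p - 1/2 - a))) * 2 powr (real j * (1/2 + 1 / real (Suc n)))"
    show "\<forall>\<delta><a. \<exists>C. \<forall>j. \<forall>t\<in>{0..1}. \<bar>?Z \<omega> j t\<bar> \<le> C * 2 powr (real j * (p - \<delta>))"
    proof (intro allI impI)
      fix \<delta> assume "\<delta> < a"
      then obtain n where n: "1 / real (Suc n) < a - \<delta>"
        using reals_Archimedean[of "a - \<delta>"] by (auto simp: inverse_eq_divide)
      obtain C where C: "\<And>j t. t \<in> {0..1} \<Longrightarrow> \<bar>?Z \<omega> j t\<bar>
          \<le> C * (A * 2 powr (real j * (p - 1/2 - a))) * 2 powr (real j * (1/2 + 1 / real (Suc n)))"
        using * by blast
      have "\<bar>?Z \<omega> j t\<bar> \<le> \<bar>C * A\<bar> * 2 powr (real j * (p - \<delta>))" if t: "t \<in> {0..1}" for j t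
      proof -
        have "\<bar>?Z \<omega> j t\<bar> \<le> C * A * (2 powr (real j * (p - 1/2 - a)) * 2 powr (real j * (1/2 + 1 / real (Suc n))))"
          using C[OF t, of j] by (simp only: mult_ac)
        also have "2 powr (real j * (p - 1/2 - a)) * 2 powr (real j * (1/2 + 1 / real (Suc n)))
            = 2 powr (real j * (p - (a - 1 / real (Suc n))))"
          by (simp add: algebra_simps flip: powr_add)
        also have "C * A * \<dots> \<le> \<bar>C * A\<bar> * 2 powr (real j * (p - \<delta>))"
          using n by (intro mult_mono powr_mono mult_left_mono) auto
        finally show ?thesis .
      qed
      then show "\<exists>C. \<forall>j. \<forall>t\<in>{0..1}. \<bar>?Z \<omega> j t\<bar> \<le> C * 2 powr (real j * (p - \<delta>))" by blast
    qed
  qed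
qed

section \<open>Regularity of dyadic series\<close>

text \<open>The iterated derivatives are unspecified outside the interval; only their values on
  the interval enter the next derivative.\<close>

lemma nth_deriv_within_eq_chain:
  assumes ab: "a < b"
    and F: "\<And>r t. r < m \<Longrightarrow> t \<in> {a..b} \<Longrightarrow>
      (F r has_field_derivative F (Suc r) t) (at t within {a..b})"
    and "r \<le> m" "t \<in> {a..b}"
  shows "nth_deriv_within r {a..b} (F 0) t = F r t"
  using assms(3,4)
proof (induction r arbitrary: t)
  case (Suc r)
  have "(F r has_vector_derivative F (Suc r) t) (at t within {a..b})"
    using F[of r t] Suc.prems by (simp add: has_real_derivative_iff_has_vector_derivative)
  then have "(nth_deriv_within r {a..b} (F 0) has_vector_derivative F (Suc r) t) (at t within {a..b})"
    by (rule has_vector_derivative_transform[rotated 2]) (use Suc in auto)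
  from vector_derivative_within_closed_interval[OF ab Suc.prems(2) this] show ?case by simp
qed simp

lemma times_differentiable_on_chain:
  assumes ab: "a < b"
    and F: "\<And>r t. r < m \<Longrightarrow> t \<in> {a..b} \<Longrightarrow>
      (F r has_field_derivative F (Suc r) t) (at t within {a..b})"
  shows "times_differentiable_on m {a..b} (F 0)"
  unfolding times_differentiable_on_def differentiable_on_def
proof (intro allI impI ballI)
  fix r t assume rt: "r < m" "t \<in> {a..b}"
  have "F r differentiable (at t within {a..b})"
    using F[OF rt] by (auto simp: has_field_derivative_def differentiable_def)
  then show "nth_deriv_within r {a..b} (F 0) differentiable (at t within {a..b})"
    by (rule differentiable_transform_within[OF _ zero_less_one rt(2)])
       (use nth_deriv_within_eq_chain[of a b m F r, OF ab F] rt in auto)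
qed

lemma summable_powr_neg:
  assumes "0 < (\<delta> :: real)"
  shows "summable (\<lambda>j. 2 powr - (real j * \<delta>))"
proof -
  have "2 powr - (real j * \<delta>) = (2 powr - \<delta>) ^ j" for j
    by (simp add: powr_powr mult.commute flip: powr_realpow)
  moreover have "2 powr - \<delta> < (1::real)" using assms by (simp add: powr_less_one)
  ultimately show ?thesis by simp
qed

text \<open>Put \<open>h = 2 ^ j * \<bar>s - t\<bar>\<close>. The increment of \<open>u j\<close> is bounded by twice the supremum of \<open>u j\<close>,
  which is the better bound when \<open>h \<ge> 1\<close>, and by \<open>\<bar>s - t\<bar>\<close> times the supremum of \<open>u' j\<close>, which is
  the better bound when \<open>h \<le> 1\<close>. Either way it is at most
  \<open>2 * C * 2 powr - (j * \<delta>) * h powr \<beta>\<close>, and \<open>\<beta> < \<delta>\<close> makes this summable in \<open>j\<close>.\<close>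

lemma hoelder_dyadic_series:
  fixes u u' :: "nat \<Rightarrow> real \<Rightarrow> real"
  assumes S: "convex S"
    and der: "\<And>j t. t \<in> S \<Longrightarrow> (u j has_field_derivative u' j t) (at t within S)"
    and u: "\<And>j t. t \<in> S \<Longrightarrow> \<bar>u j t\<bar> \<le> C * 2 powr - (real j * \<delta>)"
    and u': "\<And>j t. t \<in> S \<Longrightarrow> \<bar>u' j t\<bar> \<le> C * 2 powr (real j * (1 - \<delta>))"
    and \<beta>: "0 < \<beta>" "\<beta> < \<delta>" "\<beta> \<le> 1"
  shows "hoelder_continuous_on \<beta> S (\<lambda>t. \<Sum>j. u j t)"
proof (cases "S = {}")
  case True
  then show ?thesis by (auto simp: hoelder_continuous_on_def intro: exI[of _ 0])
next
  case False
  then obtain t0 where "t0 \<in> S" by blast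
  from u[OF this, of 0] have C0: "0 \<le> C" by simp
  let ?K = "2 * C * (\<Sum>j. 2 powr - (real j * (\<delta> - \<beta>)))"
  have sm: "summable (\<lambda>j. 2 powr - (real j * (\<delta> - \<beta>)))" using \<beta> by (intro summable_powr_neg) simp
  have sum_u: "summable (\<lambda>j. u j t)" if "t \<in> S" for t
    by (rule summable_comparison_test'[of "\<lambda>j. C * 2 powr - (real j * \<delta>)" 0])
       (use u[OF that] \<beta> in \<open>auto intro!: summable_mult summable_powr_neg\<close>)
  have key: "\<bar>u j s - u j t\<bar> \<le> 2 * C * \<bar>s - t\<bar> powr \<beta> * 2 powr - (real j * (\<delta> - \<beta>))"
    if st: "s \<in> S" "t \<in> S" for j s t
  proof (cases "s = t")
    case False
    define h where "h = 2 ^ j * \<bar>s - t\<bar>"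
    have h: "0 < h" using False by (simp add: h_def)
    have 1: "\<bar>u j s - u j t\<bar> \<le> 2 * C * 2 powr - (real j * \<delta>) * h powr \<beta>"
    proof (cases "1 \<le> h")
      case True
      have "\<bar>u j s - u j t\<bar> \<le> 2 * C * 2 powr - (real j * \<delta>)"
        using u[OF st(1), of j] u[OF st(2), of j] by linarith
      also have "\<dots> \<le> 2 * C * 2 powr - (real j * \<delta>) * h powr \<beta>"
        using True \<beta> C0 mult_left_mono[of 1 "h powr \<beta>" "2 * C * 2 powr - (real j * \<delta>)"]
        by (simp add: ge_one_powr_ge_zero)
      finally show ?thesis .
    next
      case False
      have "\<bar>u j s - u j t\<bar> \<le> C * 2 powr (real j * (1 - \<delta>)) * \<bar>s - t\<bar>"
        using field_differentiable_bound[OF S der[of _ j] _ st, of "C * 2 powr (real j * (1 - \<delta>))"] u'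
        by simp
      also have "\<dots> = C * 2 powr - (real j * \<delta>) * h"
        by (simp add: h_def algebra_simps powr_diff powr_minus divide_inverse powr_realpow)
      also have "\<dots> \<le> C * 2 powr - (real j * \<delta>) * h powr \<beta>"
        using False h \<beta> C0 powr_mono'[of \<beta> 1 h] by (intro mult_left_mono) auto
      also have "\<dots> \<le> 2 * C * 2 powr - (real j * \<delta>) * h powr \<beta>"
        using C0 by (intro mult_right_mono) auto
      finally show ?thesis .
    qed
    have "h powr \<beta> = 2 powr (real j * \<beta>) * \<bar>s - t\<bar> powr \<beta>"
      by (simp add: h_def powr_mult powr_powr flip: powr_realpow)
    then have "2 * C * 2 powr - (real j * \<delta>) * h powr \<beta>
        = 2 * C * \<bar>s - t\<bar> powr \<beta> * (2 powr - (real j * \<delta>) * 2 powr (real j * \<beta>))"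
      by simp
    also have "2 powr - (real j * \<delta>) * 2 powr (real j * \<beta>) = 2 powr - (real j * (\<delta> - \<beta>))"
      by (simp add: algebra_simps flip: powr_add)
    finally show ?thesis using 1 by (simp only:)
  qed simp
  have "\<bar>(\<Sum>j. u j s) - (\<Sum>j. u j t)\<bar> \<le> ?K * \<bar>s - t\<bar> powr \<beta>" if st: "s \<in> S" "t \<in> S" for s t
  proof -
    let ?g = "\<lambda>j. 2 * C * \<bar>s - t\<bar> powr \<beta> * 2 powr - (real j * (\<delta> - \<beta>))"
    have sg: "summable ?g" by (intro summable_mult sm)
    have "\<bar>(\<Sum>j. u j s) - (\<Sum>j. u j t)\<bar> = \<bar>\<Sum>j. u j s - u j t\<bar>"
      using sum_u st by (simp add: suminf_diff)
    also have "\<dots> \<le> (\<Sum>j. ?g j)"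
      using norm_suminf_le[OF _ sg, of "\<lambda>j. u j s - u j t"] key[OF st] by simp
    also have "\<dots> = ?K * \<bar>s - t\<bar> powr \<beta>"
      unfolding suminf_mult[OF sm] by (simp only: mult_ac)
    finally show ?thesis .
  qed
  moreover have "0 \<le> ?K" using C0 by (intro mult_nonneg_nonneg suminf_nonneg sm) auto
  ultimately show ?thesis unfolding hoelder_continuous_on_def by blast
qed

lemma hoelder_continuous_on_imp_continuous_on:
  assumes "hoelder_continuous_on \<beta> S f" "0 < \<beta>"
  shows "continuous_on S f"
  unfolding continuous_on_def
proof
  fix t assume t: "t \<in> S"
  obtain K where K: "\<And>s. s \<in> S \<Longrightarrow> \<bar>f s - f t\<bar> \<le> K * \<bar>s - t\<bar> powr \<beta>"
    using assms(1) t unfolding hoelder_continuous_on_def by blast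
  have "((\<lambda>s. K * \<bar>s - t\<bar> powr \<beta>) \<longlongrightarrow> K * \<bar>t - t\<bar> powr \<beta>) (at t within S)"
    using assms(2) by (intro tendsto_intros tendsto_powr') auto
  then have "((\<lambda>s. K * \<bar>s - t\<bar> powr \<beta>) \<longlongrightarrow> 0) (at t within S)" by simp
  then have "((\<lambda>s. f s - f t) \<longlongrightarrow> 0) (at t within S)"
    by (rule Lim_null_comparison[rotated]) (auto simp: eventually_at_filter K)
  then show "(f \<longlongrightarrow> f t) (at t within S)" by (rule LIM_zero_cancel)
qed

text \<open>Here \<open>U r j\<close> is the \<open>r\<close>-th derivative of the \<open>j\<close>-th block. The truncated difference
  \<open>r - m\<close> is \<open>0\<close> for \<open>r \<le> m\<close>, where the bound gives geometric convergence and hence termwise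
  differentiation; it is \<open>1\<close> for \<open>r = m + 1\<close>, where the blocks may grow and the bound only serves
  the Hoelder estimate for the \<open>m\<close>-th derivative. The constant \<open>\<kappa>\<close> stands for the zeroth Fourier
  mode, which lies in no block.\<close>

lemma smooth_dyadic_series:
  fixes U :: "nat \<Rightarrow> nat \<Rightarrow> real \<Rightarrow> real" and \<kappa> :: real
  assumes a: "0 < a" "a \<le> 1" 
    and der: "\<And>r j t. (U r j has_field_derivative U (Suc r) j t) (at t)"
    and bound: "\<And>r \<delta>. r \<le> Suc m \<Longrightarrow> \<delta> < a \<Longrightarrow>
      \<exists>C. \<forall>j. \<forall>t\<in>{0..1}. \<bar>U r j t\<bar> \<le> C * 2 powr (real j * (real (r - m) - \<delta>))"
  defines "f \<equiv> \<lambda>t. \<kappa> + (\<Sum>j. U 0 j t)"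
  shows "t \<in> {0..1} \<Longrightarrow> summable (\<lambda>j. U 0 j t)"
    and "times_differentiable_on m {0..1} f"
    and "\<forall>k<m. \<exists>L. L-lipschitz_on {0..1} (nth_deriv_within k {0..1} f)"
    and "continuous_on {0..1} (nth_deriv_within m {0..1} f)"
    and "\<forall>\<beta>. 0 < \<beta> \<and> \<beta> < a \<longrightarrow> hoelder_continuous_on \<beta> {0..1} (nth_deriv_within m {0..1} f)"
proof -
  have der': "(U r j has_field_derivative U (Suc r) j t) (at t within S)" for r j t S
    using der by (rule has_field_derivative_at_within)
  define g where "g j = (2::real) powr - (real j * (a/2))" for j
  have g: "summable g" unfolding g_def using a by (intro summable_powr_neg) simp
  have "\<exists>C. \<forall>j. \<forall>t\<in>{0..1}. \<bar>U r j t\<bar> \<le> C * g j" if "r \<le> m" for r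
    using bound[of r "a/2"] that a by (simp add: g_def)
  then obtain C where C: "\<And>r j t. r \<le> m \<Longrightarrow> t \<in> {0..1} \<Longrightarrow> \<bar>U r j t\<bar> \<le> C r * g j"
    by metis
  have summ: "summable (\<lambda>j. U r j t)" if "r \<le> m" "t \<in> {0..1}" for r t
    by (rule summable_comparison_test'[OF summable_mult[OF g, of "C r"], of 0]) (use C that in simp)
  then show "t \<in> {0..1} \<Longrightarrow> summable (\<lambda>j. U 0 j t)" by simp
  define F where "F r t = (if r = 0 then \<kappa> else 0) + (\<Sum>j. U r j t)" for r t
  have f: "f = F 0" by (simp add: f_def F_def fun_eq_iff)
  have F: "(F r has_field_derivative F (Suc r) t) (at t within {0..1})"
    if r: "r < m" and t: "t \<in> {0..1}" for r t
  proof -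
    have "uniform_limit {0..1} (\<lambda>n t. \<Sum>j<n. U (Suc r) j t) (\<lambda>t. \<Sum>j. U (Suc r) j t) sequentially"
      by (rule Weierstrass_m_test[OF _ summable_mult[OF g, of "C (Suc r)"]]) (use C r in simp)
    from has_field_derivative_series[OF _ der'[of r] this, of 0] summ[of r 0] r
    have "\<exists>h. \<forall>t\<in>{0..1}. (\<lambda>j. U r j t) sums h t \<and>
        (h has_field_derivative (\<Sum>j. U (Suc r) j t)) (at t within {0..1})"
      by simp
    then obtain h where h: "\<And>t. t \<in> {0..1} \<Longrightarrow> (\<lambda>j. U r j t) sums h t"
      "\<And>t. t \<in> {0..1} \<Longrightarrow> (h has_field_derivative (\<Sum>j. U (Suc r) j t)) (at t within {0..1})"
      by blast
    have "((\<lambda>t. (if r = 0 then \<kappa> else 0) + h t) has_field_derivative F (Suc r) t) (at t within {0..1})"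
      by (auto intro!: derivative_eq_intros h(2)[OF t] simp: F_def)
    then show ?thesis
      unfolding has_field_derivative_def
      by (rule has_derivative_transform[OF t, rotated])
         (use h(1) in \<open>auto simp: F_def sums_iff\<close>)
  qed
  have chain: "nth_deriv_within r {0..1} f t = F r t" if "r \<le> m" "t \<in> {0..1}" for r t
    unfolding f using nth_deriv_within_eq_chain[of 0 1 m F r t] F that by simp
  show "times_differentiable_on m {0..1} f"
    unfolding f by (rule times_differentiable_on_chain) (use F in auto)
  show "\<forall>k<m. \<exists>L. L-lipschitz_on {0..1} (nth_deriv_within k {0..1} f)"
  proof (intro allI impI)
    fix r assume r: "r < m"
    let ?L = "\<Sum>j. C (Suc r) * g j"
    have sg: "summable (\<lambda>j. C (Suc r) * g j)" by (rule summable_mult[OF g])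
    have bd: "\<bar>F (Suc r) t\<bar> \<le> ?L" if "t \<in> {0..1}" for t
      unfolding F_def real_norm_def[symmetric]
      using norm_suminf_le[OF _ sg, of "\<lambda>j. U (Suc r) j t"] C[of "Suc r" t] r that by simp
    have "?L-lipschitz_on {0..1} (F r)"
    proof (rule lipschitz_onI)
      show "0 \<le> ?L" using bd[of 0] by simp
      fix s t :: real assume st: "s \<in> {0..1}" "t \<in> {0..1}"
      show "dist (F r s) (F r t) \<le> ?L * dist s t"
        unfolding dist_norm
        by (rule field_differentiable_bound[OF _ F _ st]) (use bd r in auto)
    qed
    moreover have "?L-lipschitz_on {0..1} (nth_deriv_within r {0..1} f) \<longleftrightarrow> ?L-lipschitz_on {0..1} (F r)"
      using r chain[of r] by (intro lipschitz_on_cong) auto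
    ultimately show "\<exists>L. L-lipschitz_on {0..1} (nth_deriv_within r {0..1} f)" by blast
  qed
  show hoelder: "\<forall>\<beta>. 0 < \<beta> \<and> \<beta> < a \<longrightarrow> hoelder_continuous_on \<beta> {0..1} (nth_deriv_within m {0..1} f)"
  proof (intro allI impI)
    fix \<beta> assume \<beta>: "0 < \<beta> \<and> \<beta> < a"
    define \<delta> where "\<delta> = (\<beta> + a) / 2"
    have \<delta>: "\<beta> < \<delta>" "\<delta> < a" using \<beta> by (auto simp: \<delta>_def)
    have "\<exists>C. \<forall>j. \<forall>t\<in>{0..1}. \<bar>U m j t\<bar> \<le> C * 2 powr - (real j * \<delta>)"
      using bound[of m \<delta>] \<delta> by simp
    then obtain C1 where C1: "\<And>j t. t \<in> {0..1} \<Longrightarrow> \<bar>U m j t\<bar> \<le> C1 * 2 powr - (real j * \<delta>)"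
      by blast
    have "\<exists>C. \<forall>j. \<forall>t\<in>{0..1}. \<bar>U (Suc m) j t\<bar> \<le> C * 2 powr (real j * (1 - \<delta>))"
      using bound[of "Suc m" \<delta>] \<delta> by simp
    then obtain C2 where C2: "\<And>j t. t \<in> {0..1} \<Longrightarrow> \<bar>U (Suc m) j t\<bar> \<le> C2 * 2 powr (real j * (1 - \<delta>))"
      by blast
    have "hoelder_continuous_on \<beta> {0..1} (\<lambda>t. \<Sum>j. U m j t)"
    proof (rule hoelder_dyadic_series[of _ _ "U (Suc m)" "max C1 C2" \<delta>])
      fix j and t :: real assume t: "t \<in> {0..1}"
      show "\<bar>U m j t\<bar> \<le> max C1 C2 * 2 powr - (real j * \<delta>)"
        by (rule order.trans[OF C1[OF t]]) (simp add: mult_right_mono)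
      show "\<bar>U (Suc m) j t\<bar> \<le> max C1 C2 * 2 powr (real j * (1 - \<delta>))"
        by (rule order.trans[OF C2[OF t]]) (simp add: mult_right_mono)
    qed (use der' \<beta> \<delta> a in auto)
    then have "hoelder_continuous_on \<beta> {0..1} (F m)"
      unfolding hoelder_continuous_on_def F_def by simp
    then show "hoelder_continuous_on \<beta> {0..1} (nth_deriv_within m {0..1} f)"
      unfolding hoelder_continuous_on_def using chain[of m] by simp
  qed
  show "continuous_on {0..1} (nth_deriv_within m {0..1} f)"
    by (rule hoelder_continuous_on_imp_continuous_on[of "a/2"]) (use hoelder a in auto)
qed

section \<open>The Fourier series of the process\<close>

text \<open>A larger constant absorbs the finitely many \<open>k\<close> at which the asymptotic bound may fail. The
  index \<open>0\<close> stays excluded, as \<open>0 powr q = 0\<close> for every \<open>q\<close>.\<close>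

lemma bigo_coefficient_bound:
  fixes c :: "nat \<Rightarrow> real"
  assumes "(\<lambda>k. (c k)\<^sup>2) \<in> O(\<lambda>k. 1 / real k powr p)"
  shows "\<exists>K. \<forall>k>0. \<bar>c k\<bar> \<le> K * real k powr - (p / 2)"
proof -
  obtain B where B: "eventually (\<lambda>k. norm ((c k)\<^sup>2) \<le> B * norm (1 / real k powr p)) sequentially"
    using landau_o.bigE[OF assms] by blast
  have "eventually (\<lambda>k. norm (c k * real k powr (p / 2)) \<le> sqrt B) sequentially"
    using B eventually_gt_at_top[of 0]
  proof eventually_elim
    case (elim k)
    then have "(c k)\<^sup>2 * real k powr p \<le> B" by (simp add: field_simps)
    moreover have "(c k * real k powr (p / 2))\<^sup>2 = (c k)\<^sup>2 * real k powr p"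
      by (simp add: power_mult_distrib power2_eq_square flip: powr_add)
    ultimately show ?case by (simp add: real_le_rsqrt)
  qed
  then have "Bseq (\<lambda>k. c k * real k powr (p / 2))" by (rule BfunI)
  then obtain K where "\<And>k. norm (c k * real k powr (p / 2)) \<le> K" unfolding Bseq_def by blast
  then have "\<bar>c k\<bar> \<le> K * real k powr - (p / 2)" if "0 < k" for k
    using that by (simp add: powr_minus abs_mult field_simps)
  then show ?thesis by blast
qed

text \<open>Differentiating \<open>r\<close> times turns the exponent \<open>- (1/2 + m + a)\<close> into
  \<open>e = r - m - 1/2 - a\<close>. On the block \<open>2 ^ j \<le> k < 2 ^ (j + 1)\<close> the power \<open>k powr e\<close> is maximal at the
  left end when \<open>r \<le> m\<close>, and at the right end when \<open>r = m + 1\<close>, where \<open>a \<le> 1/2\<close> makes \<open>e\<close>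
  nonnegative; the right end costs the factor \<open>2\<close>.\<close>

lemma dyadic_derivative_coefficient_bound:
  fixes c :: "nat \<Rightarrow> real"
  assumes c: "\<And>k. 0 < k \<Longrightarrow> \<bar>c k\<bar> \<le> K * real k powr - (1/2 + real m + a)"
    and a: "0 < a" "a \<le> 1/2" and r: "r \<le> Suc m" and k: "k \<in> dyadic_block j"
  shows "\<bar>sqrt 2 * (2 * pi * real k) ^ r * c k\<bar>
      \<le> 2 * sqrt 2 * (2 * pi) ^ r * K * 2 powr (real j * (real (r - m) - 1/2 - a))"
proof -
  note kb = dyadic_blockD[OF k]
  have k0: "0 < real k" using kb(3) by simp
  have "0 \<le> K" using c[of 1] by simp
  define e where "e = real r - real m - 1/2 - a"
  have e: "real k powr e \<le> 2 * 2 powr (real j * (real (r - m) - 1/2 - a))"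
  proof (cases "r \<le> m")
    case True
    have "real k powr e \<le> (2 ^ j) powr e"
      using kb a True by (intro powr_mono2') (auto simp: e_def)
    also have "\<dots> = 2 powr (real j * e)" by (simp add: powr_powr flip: powr_realpow)
    also have "\<dots> \<le> 2 powr (real j * (real (r - m) - 1/2 - a))"
      using True by (intro powr_mono mult_left_mono) (auto simp: e_def)
    also have "\<dots> \<le> 2 * \<dots>" by simp
    finally show ?thesis .
  next
    case False
    then have e': "e = real (r - m) - 1/2 - a" "0 \<le> e" "e \<le> 1" using r a by (auto simp: e_def not_le)
    have "real k powr e \<le> (2 * 2 ^ j) powr e" using kb e' by (intro powr_mono2) auto
    also have "\<dots> = 2 powr e * 2 powr (real j * e)" by (simp add: powr_mult powr_powr flip: powr_realpow)
    also have "\<dots> \<le> 2 * 2 powr (real j * e)"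
      using e' powr_mono[of e 1 2] by (intro mult_right_mono) auto
    finally show ?thesis by (simp add: e')
  qed
  have "\<bar>sqrt 2 * (2 * pi * real k) ^ r * c k\<bar> = sqrt 2 * (2 * pi) ^ r * (real k ^ r * \<bar>c k\<bar>)"
    by (simp add: abs_mult power_mult_distrib)
  also have "\<dots> \<le> sqrt 2 * (2 * pi) ^ r * (real k ^ r * (K * real k powr - (1/2 + real m + a)))"
    using c[of k] k0 by (intro mult_left_mono) auto
  also have "real k ^ r * (K * real k powr - (1/2 + real m + a)) = K * real k powr e"
    using k0 by (simp add: e_def algebra_simps flip: powr_realpow powr_add)
  also have "sqrt 2 * (2 * pi) ^ r * (K * real k powr e)
      \<le> sqrt 2 * (2 * pi) ^ r * (K * (2 * 2 powr (real j * (real (r - m) - 1/2 - a))))"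
    using e \<open>0 \<le> K\<close> by (intro mult_left_mono) auto
  finally show ?thesis by (simp add: mult_ac)
qed

text \<open>By Fatou's lemma, the mean square distance of \<open>X\<close> and the pointwise limit \<open>Z\<close> is at most
  the limit inferior of the mean square distances, which vanishes.\<close>

lemma AE_eq_of_mean_square_limit:
  fixes X Z :: "'a \<Rightarrow> real" and S :: "nat \<Rightarrow> 'a \<Rightarrow> real"
  assumes [measurable]: "X \<in> borel_measurable M" "Z \<in> borel_measurable M"
      "\<And>n. S n \<in> borel_measurable M"
    and L2: "(\<lambda>n. \<integral>\<^sup>+\<omega>. ennreal ((X \<omega> - S n \<omega>)\<^sup>2) \<partial>M) \<longlonglongrightarrow> 0"
    and ae: "AE \<omega> in M. (\<lambda>n. S n \<omega>) \<longlonglongrightarrow> Z \<omega>"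
  shows "AE \<omega> in M. Z \<omega> = X \<omega>"
proof -
  have "(\<integral>\<^sup>+\<omega>. ennreal ((X \<omega> - Z \<omega>)\<^sup>2) \<partial>M) = (\<integral>\<^sup>+\<omega>. liminf (\<lambda>n. ennreal ((X \<omega> - S n \<omega>)\<^sup>2)) \<partial>M)"
  proof (rule nn_integral_cong_AE)
    show "AE \<omega> in M. ennreal ((X \<omega> - Z \<omega>)\<^sup>2) = liminf (\<lambda>n. ennreal ((X \<omega> - S n \<omega>)\<^sup>2))"
      using ae
    proof eventually_elim
      case (elim \<omega>)
      have "(\<lambda>n. ennreal ((X \<omega> - S n \<omega>)\<^sup>2)) \<longlonglongrightarrow> ennreal ((X \<omega> - Z \<omega>)\<^sup>2)"
        by (intro tendsto_intros elim)
      from lim_imp_Liminf[OF _ this] show ?case by simp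
    qed
  qed
  also have "\<dots> \<le> liminf (\<lambda>n. \<integral>\<^sup>+\<omega>. ennreal ((X \<omega> - S n \<omega>)\<^sup>2) \<partial>M)"
    by (rule nn_integral_liminf) measurable
  also have "\<dots> = 0" using lim_imp_Liminf[OF _ L2] by simp
  finally have "(\<integral>\<^sup>+\<omega>. ennreal ((X \<omega> - Z \<omega>)\<^sup>2) \<partial>M) = 0" by simp
  then have "AE \<omega> in M. ennreal ((X \<omega> - Z \<omega>)\<^sup>2) = 0"
    by (subst (asm) nn_integral_0_iff_AE) auto
  then show ?thesis by eventually_elim simp
qed

lemma sum_dyadic_blocks:
  fixes f :: "nat \<Rightarrow> 'b :: comm_monoid_add"
  shows "(\<Sum>k=1..2 ^ n - 1. f k) = (\<Sum>j<n. \<Sum>k\<in>dyadic_block j. f k)"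
proof (induction n)
  case (Suc n)
  have "{1..2 ^ Suc n - 1} = {1..2 ^ n - 1} \<union> dyadic_block n"
    using one_le_power[of "2::nat" n] by (auto simp: dyadic_block_def simp del: one_le_power)
  moreover have "{1..2 ^ n - 1} \<inter> dyadic_block n = {}" by (auto simp: dyadic_block_def)
  ultimately have "(\<Sum>k=1..2 ^ Suc n - 1. f k) = (\<Sum>k=1..2 ^ n - 1. f k) + (\<Sum>k\<in>dyadic_block n. f k)"
    by (simp only: sum.union_disjoint finite_atLeastAtMost finite_dyadic_block)
  then show ?case by (simp only: Suc.IH sum.lessThan_Suc)
qed simp

theorem corollary2p2:
  fixes M :: "'a measure"
    and Y Y' :: "nat \<Rightarrow> 'a \<Rightarrow> real"
    and c :: "nat \<Rightarrow> real"
    and x :: "real \<Rightarrow> 'a \<Rightarrow> real"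
    and m :: nat
    and \<alpha> :: real
  assumes "prob_space M"
    and "\<And>n. distributed M lborel (Y n) std_normal_density"
    and "\<And>n. distributed M lborel (Y' n) std_normal_density"
    and "prob_space.indep_vars M (\<lambda>_. borel) Y UNIV"
    and "prob_space.indep_vars M (\<lambda>_. borel) Y' UNIV"
    and "prob_space.indep_var M
           (Pi\<^sub>M UNIV (\<lambda>_. borel)) (\<lambda>\<omega>. \<lambda>n\<in>UNIV. Y n \<omega>)
           (Pi\<^sub>M UNIV (\<lambda>_. borel)) (\<lambda>\<omega>. \<lambda>n\<in>UNIV. Y' n \<omega>)"
    and "summable (\<lambda>k. (c k)\<^sup>2)"
    and "x \<in> periodic_stationary_gaussian M"
    and "mean_square_uniform_limit M {0..1} (fourier_partial_sum c Y Y') x"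
    and "0 < m"
    and "0 < \<alpha>" and "\<alpha> \<le> 1"
    and "(\<lambda>k. (c k)\<^sup>2) \<in> O(\<lambda>k. 1 / real k powr (1 + 2 * real m + \<alpha>))"
  shows "\<exists>z. modification M {0..1} x z \<and>
    (AE \<omega> in M.
       times_differentiable_on m {0..1} (\<lambda>t. z t \<omega>) \<and>
       (\<forall>k<m. \<exists>L. L-lipschitz_on {0..1} (nth_deriv_within k {0..1} (\<lambda>t. z t \<omega>))) \<and>
       continuous_on {0..1} (nth_deriv_within m {0..1} (\<lambda>t. z t \<omega>)) \<and>
       (\<forall>\<beta>. 0 < \<beta> \<and> \<beta> < \<alpha> / 2 \<longrightarrow>
          hoelder_continuous_on \<beta> {0..1} (nth_deriv_within m {0..1} (\<lambda>t. z t \<omega>))))"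
proof -
  interpret prob_space M by fact
  note Y = assms(2) and Y' = assms(3) and indY = assms(4) and indY' = assms(5)
  have [measurable]: "Y k \<in> borel_measurable M" "Y' k \<in> borel_measurable M" for k
    using distributed_measurable[OF Y[of k]] distributed_measurable[OF Y'[of k]] by simp_all
  define a where "a = \<alpha> / 2"
  have a: "0 < a" "a \<le> 1/2" using assms by (simp_all add: a_def)
  obtain K where K: "\<And>k. 0 < k \<Longrightarrow> \<bar>c k\<bar> \<le> K * real k powr - (1/2 + real m + a)"
    using bigo_coefficient_bound[OF assms(13)] by (auto simp: a_def add_divide_distrib)
  define d where "d r k = sqrt 2 * (2 * pi * real k) ^ r * c k" for r k
  \<comment> \<open>The \<open>r\<close>-th derivative of a block of the sine part (\<open>\<phi> = 0\<close>) or of the cosine part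
      (\<open>\<phi> = pi / 2\<close>): each differentiation advances the phase by \<open>pi / 2\<close>.\<close>
  define V where "V X \<phi> r j t \<omega> =
      (\<Sum>k\<in>dyadic_block j. d r k * X k \<omega> * sin (2 * pi * real k * t + (\<phi> + real r * (pi / 2))))"
    for X :: "nat \<Rightarrow> 'a \<Rightarrow> real" and \<phi> r j t \<omega>
  define U where "U \<omega> r j t = V Y 0 r j t \<omega> + V Y' (pi / 2) r j t \<omega>" for \<omega> r j t
  define z where "z t \<omega> = c 0 * Y' 0 \<omega> + (\<Sum>j. U \<omega> 0 j t)" for t \<omega>

  have V_decay: "AE \<omega> in M. \<forall>r\<in>{..Suc m}. \<forall>\<delta><a. \<exists>C. \<forall>j. \<forall>t\<in>{0..1}.
      \<bar>V X \<phi> r j t \<omega>\<bar> \<le> C * 2 powr (real j * (real (r - m) - \<delta>))"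
    if X: "\<And>n. distributed M lborel (X n) std_normal_density" "indep_vars (\<lambda>_. borel) X UNIV" for X \<phi>
    unfolding V_def
    by (intro AE_finite_allI random_trig_block_decay[OF X] finite_atMost)
       (simp only: d_def atMost_iff, rule dyadic_derivative_coefficient_bound[OF K a])
  have good: "AE \<omega> in M. \<forall>r\<le>Suc m. \<forall>\<delta><a. \<exists>C. \<forall>j. \<forall>t\<in>{0..1}.
      \<bar>U \<omega> r j t\<bar> \<le> C * 2 powr (real j * (real (r - m) - \<delta>))"
    using V_decay[OF Y indY, of 0] V_decay[OF Y' indY', of "pi / 2"]
  proof eventually_elim
    case (elim \<omega>)
    show ?case
    proof (intro allI impI)
      fix r and \<delta> :: real assume r: "r \<le> Suc m" and \<delta>: "\<delta> < a"
      from elim r \<delta> obtain C C' where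
        C: "\<And>j t. t \<in> {0..1} \<Longrightarrow> \<bar>V Y 0 r j t \<omega>\<bar> \<le> C * 2 powr (real j * (real (r - m) - \<delta>))"
           "\<And>j t. t \<in> {0..1} \<Longrightarrow> \<bar>V Y' (pi / 2) r j t \<omega>\<bar> \<le> C' * 2 powr (real j * (real (r - m) - \<delta>))"
        unfolding Ball_def atMost_iff by meson
      have "\<bar>U \<omega> r j t\<bar> \<le> (C + C') * 2 powr (real j * (real (r - m) - \<delta>))" if "t \<in> {0..1}" for j t
        using C(1)[OF that, of j] C(2)[OF that, of j] unfolding U_def distrib_right by linarith
      then show "\<exists>C. \<forall>j. \<forall>t\<in>{0..1}. \<bar>U \<omega> r j t\<bar> \<le> C * 2 powr (real j * (real (r - m) - \<delta>))"
        by blast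
    qed
  qed
  have U_deriv: "(U \<omega> r j has_field_derivative U \<omega> (Suc r) j t) (at t)" for \<omega> r j t
  proof -
    have "((\<lambda>t. V X \<phi> r j t \<omega>) has_field_derivative V X \<phi> (Suc r) j t \<omega>) (at t)" for X \<phi>
      unfolding V_def
    proof (rule DERIV_sum)
      fix k
      have "2 * pi * real k * t + (\<phi> + real (Suc r) * (pi / 2))
          = (2 * pi * real k * t + (\<phi> + real r * (pi / 2))) + pi / 2"
        by (simp add: distrib_right)
      then have "sin (2 * pi * real k * t + (\<phi> + real (Suc r) * (pi / 2)))
          = cos (2 * pi * real k * t + (\<phi> + real r * (pi / 2)))"
        by (simp only: sin_add) simp
      then show "((\<lambda>t. d r k * X k \<omega> * sin (2 * pi * real k * t + (\<phi> + real r * (pi / 2))))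
          has_field_derivative
          d (Suc r) k * X k \<omega> * sin (2 * pi * real k * t + (\<phi> + real (Suc r) * (pi / 2)))) (at t)"
        unfolding d_def by (auto intro!: derivative_eq_intros)
    qed
    then show ?thesis unfolding U_def by (intro DERIV_add)
  qed
  note summable_U = smooth_dyadic_series(1)[where a = a and U = "U \<omega>" and m = m for \<omega>, OF a(1) _ U_deriv]
  note path = smooth_dyadic_series(2-5)[where a = a and U = "U \<omega>" and m = m and \<kappa> = "c 0 * Y' 0 \<omega>" for \<omega>,
      OF a(1) _ U_deriv, folded z_def]
  \<comment> \<open>Along \<open>2 ^ n - 1\<close> the partial sums end at a block boundary.\<close>
  have partial: "fourier_partial_sum c Y Y' (2 ^ n - 1) t \<omega> = c 0 * Y' 0 \<omega> + (\<Sum>j<n. U \<omega> 0 j t)" for n t \<omega>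
    unfolding fourier_partial_sum_def sum_dyadic_blocks U_def V_def sum.distrib[symmetric] d_def
    by (intro arg_cong2[where f = "(+)"] refl sum.cong)
       (simp add: sin_add algebra_simps)
  have "modification M {0..1} x z"
    unfolding modification_def
  proof (intro ballI conjI)
    fix t :: real assume t: "t \<in> {0..1}"
    have [measurable]: "(\<lambda>\<omega>. U \<omega> 0 j t) \<in> borel_measurable M" for j
      unfolding U_def V_def by measurable
    show z_meas [measurable]: "z t \<in> borel_measurable M" unfolding z_def by measurable
    have "gaussian_process M {0..1} x" using assms(8) by (simp add: periodic_stationary_gaussian_def)
    then have "gaussian_rv M (\<lambda>\<omega>. \<Sum>s\<in>{t}. 1 * x s \<omega>)"
      unfolding gaussian_process_def using t by (elim allE[of _ "{t}"] allE[of _ "\<lambda>_. 1"]) auto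
    then have x_meas: "x t \<in> borel_measurable M" by (simp add: gaussian_rv_def)
    show "AE \<omega> in M. z t \<omega> = x t \<omega>"
    proof (rule AE_eq_of_mean_square_limit[OF x_meas z_meas])
      show "fourier_partial_sum c Y Y' (2 ^ n - 1) t \<in> borel_measurable M" for n
        unfolding partial by measurable
      have "(\<lambda>n. \<integral>\<^sup>+\<omega>. ennreal ((x t \<omega> - fourier_partial_sum c Y Y' n t \<omega>)\<^sup>2) \<partial>M) \<longlonglongrightarrow> 0"
      proof (rule tendsto_sandwich[OF _ _ tendsto_const])
        show "(\<lambda>n. SUP t\<in>{0..1}. \<integral>\<^sup>+\<omega>. ennreal ((x t \<omega> - fourier_partial_sum c Y Y' n t \<omega>)\<^sup>2) \<partial>M) \<longlonglongrightarrow> 0"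
          using assms(9) by (simp add: mean_square_uniform_limit_def)
      qed (use t in \<open>auto intro!: always_eventually SUP_upper\<close>)
      moreover have "filterlim (\<lambda>n. 2 ^ n - 1 :: nat) at_top sequentially"
      proof (rule filterlim_at_top_mono[OF filterlim_ident always_eventually], rule allI)
        show "n \<le> 2 ^ n - 1" for n :: nat using less_exp[of n] by linarith
      qed
      ultimately show "(\<lambda>n. \<integral>\<^sup>+\<omega>. ennreal ((x t \<omega> - fourier_partial_sum c Y Y' (2 ^ n - 1) t \<omega>)\<^sup>2) \<partial>M) \<longlonglongrightarrow> 0"
        by (rule filterlim_compose)
      show "AE \<omega> in M. (\<lambda>n. fourier_partial_sum c Y Y' (2 ^ n - 1) t \<omega>) \<longlonglongrightarrow> z t \<omega>"
        using good
      proof eventually_elim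
        case (elim \<omega>)
        have "summable (\<lambda>j. U \<omega> 0 j t)" by (rule summable_U) (use a t elim in auto)
        then show ?case unfolding partial z_def by (intro tendsto_intros summable_LIMSEQ)
      qed
    qed
  qed
  moreover have "AE \<omega> in M.
       times_differentiable_on m {0..1} (\<lambda>t. z t \<omega>) \<and>
       (\<forall>k<m. \<exists>L. L-lipschitz_on {0..1} (nth_deriv_within k {0..1} (\<lambda>t. z t \<omega>))) \<and>
       continuous_on {0..1} (nth_deriv_within m {0..1} (\<lambda>t. z t \<omega>)) \<and>
       (\<forall>\<beta>. 0 < \<beta> \<and> \<beta> < \<alpha> / 2 \<longrightarrow>
          hoelder_continuous_on \<beta> {0..1} (nth_deriv_within m {0..1} (\<lambda>t. z t \<omega>)))"
    using good
  proof eventually_elim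
    case (elim \<omega>)
    show ?case unfolding a_def[symmetric]
      by (intro conjI path) (use a elim in auto)
  qed
  ultimately show ?thesis by blast
qed

end
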